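(* Let $\Sigma$ be a connected Riemannian surface with Laplacian $\Delta$. Let $g\in C^0(\Sigma)$, let $h$ be a non-negative continuous function on $\Sigma$, and let $v\in C^2(\Sigma)$ satisfy $\|\nabla v\|^2\leq h\,v^2$ on $\Sigma$ and $\Delta v+g\,v=0$ in $\Sigma$. Then either $v$ never vanishes on $\Sigma$ or $v$ vanishes identically on $\Sigma$.
   Context: $\Delta$ is the Laplacian (divergence of the gradient) and $\nabla$ the gradient with respect to the Riemannian metric on $\Sigma$; all functions are real-valued. *)

theory Defs
  imports "HOL-Analysis.Analysis"
begin

text \<open>
  Surfaces are second countable Hausdorff spaces (the topology \<open>M\<close>) with a smooth atlas \<open>A\<close>
  of charts into the plane. A Riemannian metric is given by its matrix of components in each chart
  of the atlas, subject to the transformation law of a covariant 2-tensor; tangent vectors and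
  vector fields are likewise handled through their components in the charts.
\<close>

text \<open>Only used for open \<open>S\<close>, where \<open>differentiable_on\<close> and \<open>frechet_derivative f (at x)\<close> agree.\<close>

primrec Ck_on :: "nat \<Rightarrow> ('a::euclidean_space \<Rightarrow> 'b::real_normed_vector) \<Rightarrow> 'a set \<Rightarrow> bool" where
  "Ck_on 0 f S \<longleftrightarrow> continuous_on S f"
| "Ck_on (Suc k) f S \<longleftrightarrow>
     f differentiable_on S \<and> (\<forall>b\<in>Basis. Ck_on k (\<lambda>x. frechet_derivative f (at x) b) S)"

definition smooth_on :: "('a::euclidean_space \<Rightarrow> 'b::real_normed_vector) \<Rightarrow> 'a set \<Rightarrow> bool" where
  "smooth_on f S \<longleftrightarrow> (\<forall>k. Ck_on k f S)"

definition partial :: "2 \<Rightarrow> (real^2 \<Rightarrow> real) \<Rightarrow> real^2 \<Rightarrow> real" where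
  "partial i f x = frechet_derivative f (at x) (axis i 1)"


subsection \<open>Smooth surfaces\<close>

text \<open>A chart is its domain together with the coordinate map, which is irrelevant off the domain.\<close>

type_synonym 'a chart = "'a set \<times> ('a \<Rightarrow> real^2)"

abbreviation dom_chart :: "'a chart \<Rightarrow> 'a set" where
  "dom_chart c \<equiv> fst c"

abbreviation coord :: "'a chart \<Rightarrow> 'a \<Rightarrow> real^2" where
  "coord c \<equiv> snd c"

abbreviation codom_chart :: "'a chart \<Rightarrow> (real^2) set" where
  "codom_chart c \<equiv> coord c ` dom_chart c"

definition inv_coord :: "'a chart \<Rightarrow> real^2 \<Rightarrow> 'a" where
  "inv_coord c = inv_into (dom_chart c) (coord c)"

definition is_chart :: "'a topology \<Rightarrow> 'a chart \<Rightarrow> bool" where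
  "is_chart M c \<longleftrightarrow> openin M (dom_chart c) \<and> open (codom_chart c) \<and>
     homeomorphic_map (subtopology M (dom_chart c)) (top_of_set (codom_chart c)) (coord c)"

definition transition :: "'a chart \<Rightarrow> 'a chart \<Rightarrow> real^2 \<Rightarrow> real^2" where
  "transition c d = coord d \<circ> inv_coord c"

definition smooth_surface :: "'a topology \<Rightarrow> 'a chart set \<Rightarrow> bool" where
  "smooth_surface M A \<longleftrightarrow>
     Hausdorff_space M \<and> second_countable M \<and>
     (\<forall>c\<in>A. is_chart M c) \<and> (\<Union>c\<in>A. dom_chart c) = topspace M \<and>
     (\<forall>c\<in>A. \<forall>d\<in>A. smooth_on (transition c d) (coord c ` (dom_chart c \<inter> dom_chart d)))"

definition C2_surface :: "'a chart set \<Rightarrow> ('a \<Rightarrow> real) \<Rightarrow> bool" where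
  "C2_surface A v \<longleftrightarrow> (\<forall>c\<in>A. Ck_on 2 (v \<circ> inv_coord c) (codom_chart c))"


subsection \<open>Riemannian metrics\<close>

text \<open>\<open>G c x\<close> is the matrix of the metric in the chart \<open>c\<close> at the point with coordinates \<open>x\<close>.\<close>

definition riemannian_metric :: "'a chart set \<Rightarrow> ('a chart \<Rightarrow> real^2 \<Rightarrow> real^2^2) \<Rightarrow> bool" where
  "riemannian_metric A G \<longleftrightarrow>
     (\<forall>c\<in>A. smooth_on (G c) (codom_chart c) \<and>
        (\<forall>x\<in>codom_chart c. transpose (G c x) = G c x \<and> (\<forall>w. w \<noteq> 0 \<longrightarrow> w \<bullet> (G c x *v w) > 0))) \<and>
     (\<forall>c\<in>A. \<forall>d\<in>A. \<forall>x\<in>coord c ` (dom_chart c \<inter> dom_chart d).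
        G c x = transpose (jacobian (transition c d) (at x)) ** G d (transition c d x)
                  ** jacobian (transition c d) (at x))"

definition riemannian_surface ::
    "'a topology \<Rightarrow> 'a chart set \<Rightarrow> ('a chart \<Rightarrow> real^2 \<Rightarrow> real^2^2) \<Rightarrow> bool" where
  "riemannian_surface M A G \<longleftrightarrow> smooth_surface M A \<and> riemannian_metric A G"


subsection \<open>Gradient, divergence and Laplacian\<close>

text \<open>
  A vector field \<open>X\<close> is given by its components \<open>X c x\<close> in the chart \<open>c\<close> at the point with
  coordinates \<open>x\<close>. For components that transform as those of a vector (in particular for a gradient),
  norm and divergence at \<open>p\<close> come out the same in all charts around \<open>p\<close>; they are evaluated in one
  of them.
\<close>

definition chart_at :: "'a chart set \<Rightarrow> 'a \<Rightarrow> 'a chart" where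
  "chart_at A p = (SOME c. c \<in> A \<and> p \<in> dom_chart c)"

text \<open>\<open>(\<nabla>v)\<^sup>i = \<Sum>j. g\<^sup>i\<^sup>j \<partial>\<^sub>jv\<close>\<close>

definition gradient ::
    "('a chart \<Rightarrow> real^2 \<Rightarrow> real^2^2) \<Rightarrow> ('a \<Rightarrow> real) \<Rightarrow> 'a chart \<Rightarrow> real^2 \<Rightarrow> real^2" where
  "gradient G v c x = matrix_inv (G c x) *v (\<chi> j. partial j (v \<circ> inv_coord c) x)"

definition field_norm ::
    "'a chart set \<Rightarrow> ('a chart \<Rightarrow> real^2 \<Rightarrow> real^2^2) \<Rightarrow> ('a chart \<Rightarrow> real^2 \<Rightarrow> real^2) \<Rightarrow> 'a \<Rightarrow> real" where
  "field_norm A G X p =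
     (let c = chart_at A p; x = coord c p in sqrt (X c x \<bullet> (G c x *v X c x)))"

text \<open>\<open>div X = (det g)\<^sup>-\<^sup>1\<^sup>/\<^sup>2 \<Sum>i. \<partial>\<^sub>i ((det g)\<^sup>1\<^sup>/\<^sup>2 X\<^sup>i)\<close>\<close>

definition divergence ::
    "'a chart set \<Rightarrow> ('a chart \<Rightarrow> real^2 \<Rightarrow> real^2^2) \<Rightarrow> ('a chart \<Rightarrow> real^2 \<Rightarrow> real^2) \<Rightarrow> 'a \<Rightarrow> real" where
  "divergence A G X p =
     (let c = chart_at A p; x = coord c p
      in (\<Sum>i\<in>UNIV. partial i (\<lambda>y. sqrt (det (G c y)) * X c y $ i) x) / sqrt (det (G c x)))"

definition laplacian ::
    "'a chart set \<Rightarrow> ('a chart \<Rightarrow> real^2 \<Rightarrow> real^2^2) \<Rightarrow> ('a \<Rightarrow> real) \<Rightarrow> 'a \<Rightarrow> real" where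
  "laplacian A G v p = divergence A G (gradient G v) p"

end

theory Submission
  imports Defs
begin

text \<open>
  The gradient bound alone forces the dichotomy. In a chart it reads \<open>\<bar>u'\<bar> \<le> C \<bar>u\<bar>\<close> on each compact
  ball, so by Gronwall along rays a zero of \<open>u\<close> propagates to the whole ball. Hence the zero set
  of \<open>v\<close> is open; it is also closed, and the surface is connected.
\<close>

subsection \<open>Positive definite matrices\<close>

lemma positive_definite_invertible:
  fixes A :: "real^'n^'n"
  assumes "\<And>w. w \<noteq> 0 \<Longrightarrow> 0 < w \<bullet> (A *v w)"
  shows "invertible A"
  unfolding invertible_left_inverse matrix_left_invertible_ker
  using assms by (metis inner_zero_right less_irrefl)

lemma matrix_inv_vector:
  fixes A :: "real^'n^'n"
  assumes "invertible A"
  shows "A *v (matrix_inv A *v w) = w"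
proof -
  have "A ** matrix_inv A = mat 1"
    unfolding matrix_inv_def using assms[unfolded invertible_def] by (rule someI2_ex) simp
  then show ?thesis
    by (simp add: matrix_vector_mul_assoc)
qed

lemma transpose_inner:
  fixes A :: "real^'n^'m"
  shows "(transpose A *v x) \<bullet> y = x \<bullet> (A *v y)"
  by (metis dot_lmul_matrix transpose_matrix_vector)

text \<open>This is the coordinate invariance of the squared gradient norm. \<open>A\<close> and
  \<open>B\<close> play the metric matrices in two charts, \<open>J\<close> the Jacobian of the
  transition between them, and \<open>w\<close> and \<open>transpose J *v w\<close> the differential
  of one function in the two charts. The vector \<open>matrix_inv A *v (transpose J *v w)\<close> is
  carried by \<open>J\<close> to \<open>matrix_inv B *v w\<close>, and \<open>J\<close> turns the
  form of \<open>B\<close> into that of \<open>A\<close>.\<close>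

lemma inverse_quadratic_form_congruence:
  fixes A B J :: "real^'n^'n"
  assumes A: "invertible A" and B: "invertible B" and AB: "A = transpose J ** B ** J"
  shows "(matrix_inv A *v (transpose J *v w)) \<bullet> (A *v (matrix_inv A *v (transpose J *v w)))
    = (matrix_inv B *v w) \<bullet> (B *v (matrix_inv B *v w))"
proof -
  define X where "X = matrix_inv A *v (transpose J *v w)"
  \<comment> \<open>The determinant of \<open>A\<close> is nonzero and is a product with this
    factor, so \<open>transpose J\<close> can be cancelled below.\<close>
  have "det (transpose J) \<noteq> 0"
    using A AB by (simp add: invertible_det_nz det_mul)
  then have inj: "inj ((*v) (transpose J))"
    using invertible_det_nz invertible_left_inverse matrix_left_invertible_injective by blast
  have "transpose J *v (B *v (J *v X)) = A *v X"
    by (simp add: AB matrix_vector_mul_assoc matrix_mul_assoc)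
  also have "\<dots> = transpose J *v w"
    unfolding X_def using A by (rule matrix_inv_vector)
  finally have "B *v (J *v X) = w"
    using inj injD by metis
  \<comment> \<open>\<open>B\<close> sends both \<open>J *v X\<close> and
    \<open>matrix_inv B *v w\<close> to \<open>w\<close>; being injective, it identifies
    them.\<close>
  then have "(matrix_inv B *v w) \<bullet> (B *v (matrix_inv B *v w)) = (J *v X) \<bullet> (B *v (J *v X))"
    using matrix_inv_vector[OF B, of w] B
    by (metis invertible_left_inverse matrix_left_invertible_injective injD)
  also have "\<dots> = X \<bullet> (A *v X)"
    using transpose_inner[of J "B *v (J *v X)" X]
    by (simp add: AB inner_commute flip: matrix_vector_mul_assoc)
  finally show ?thesis
    by (simp add: X_def)
qed

text \<open>If all eigenvalues of \<open>A\<close> are at most \<open>K\<close>, those of its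
  inverse are at least \<open>1/K\<close>. Instead of diagonalising, the proof expands the form of
  \<open>A\<close> at a well-chosen vector, where it is non-negative.\<close>

lemma norm_le_inverse_quadratic_form:
  fixes A :: "real^'n^'n"
  assumes sym: "transpose A = A" and pos: "\<And>w. w \<noteq> 0 \<Longrightarrow> 0 < w \<bullet> (A *v w)"
    and K: "0 < K" "\<And>w. w \<bullet> (A *v w) \<le> K * (norm w)\<^sup>2"
  shows "(norm w)\<^sup>2 \<le> K * ((matrix_inv A *v w) \<bullet> (A *v (matrix_inv A *v w)))"
proof -
  define X where "X = matrix_inv A *v w"
  \<comment> \<open>For \<open>X - s w\<close> the expansion is at most
    \<open>X \<bullet> (A *v X) - 2 s |w|^2 + s^2 K |w|^2\<close>, which is smallest at
    \<open>s = 1/K\<close>.\<close>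
  define Y where "Y = X - (1/K) *\<^sub>R w"
  have AX: "A *v X = w"
    unfolding X_def by (intro matrix_inv_vector positive_definite_invertible pos)
  have XA: "X \<bullet> (A *v w) = w \<bullet> w"
    using transpose_inner[of A X w] by (simp add: sym AX)
  have "0 \<le> Y \<bullet> (A *v Y)"
    using pos[of Y] by (cases "Y = 0") auto
  also have "Y \<bullet> (A *v Y) = X \<bullet> (A *v X) - 2/K * (w \<bullet> w) + (1/K)\<^sup>2 * (w \<bullet> (A *v w))"
    unfolding Y_def
    by (simp add: matrix_vector_mult_diff_distrib matrix_vector_mult_scaleR inner_diff_left
        inner_diff_right AX XA power2_eq_square inner_commute[of X w] diff_divide_distrib)
  also have "\<dots> \<le> X \<bullet> (A *v X) - 2/K * (w \<bullet> w) + (1/K)\<^sup>2 * (K * (norm w)\<^sup>2)"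
    using K(2)[of w] by (intro add_left_mono mult_left_mono) auto
  also have "\<dots> = X \<bullet> (A *v X) - (norm w)\<^sup>2 / K"
    using K(1) by (simp add: power2_eq_square field_simps flip: power2_norm_eq_inner)
  finally show ?thesis
    using K(1) by (simp add: X_def field_simps)
qed

text \<open>Entries are bounded by the norm of the matrix, and the operator norm by the number of
  entries times that bound. The constant is crude; what matters is that it depends on
  \<open>B\<close> only, so it is uniform over a compact set of matrices.\<close>

lemma quadratic_form_bound:
  fixes A :: "real^'n^'n"
  assumes "norm A \<le> B"
  shows "w \<bullet> (A *v w) \<le> (real CARD('n) * real CARD('n) * B) * (norm w)\<^sup>2"
proof -
  have "\<bar>A $ i $ j\<bar> \<le> B" for i j
    using assms component_le_norm_cart[of "A $ i" j] Finite_Cartesian_Product.norm_nth_le[of A i] by linarith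
  then have *: "onorm ((*v) A) \<le> real CARD('n) * real CARD('n) * B"
    by (rule onorm_le_matrix_component)
  have "w \<bullet> (A *v w) \<le> norm w * norm (A *v w)"
    by (rule norm_cauchy_schwarz)
  also have "\<dots> \<le> norm w * (onorm ((*v) A) * norm w)"
    by (intro mult_left_mono onorm matrix_vector_mul_bounded_linear) auto
  also have "\<dots> \<le> norm w * ((real CARD('n) * real CARD('n) * B) * norm w)"
    by (intro mult_left_mono mult_right_mono *) auto
  finally show ?thesis
    by (simp add: power2_eq_square algebra_simps)
qed


subsection \<open>Propagation of zeros\<close>

text \<open>The function \<open>exp (- 2 C t) f(t)^2\<close> is non-negative, starts at zero and
  does not increase, because \<open>f f'\<close> is at most \<open>C f^2\<close>. The factor 2 in
  the exponent matches the square.\<close>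

lemma gronwall_zero:
  fixes f f' :: "real \<Rightarrow> real"
  assumes der: "\<And>t. 0 \<le> t \<Longrightarrow> t \<le> 1 \<Longrightarrow> (f has_real_derivative f' t) (at t)"
    and bound: "\<And>t. 0 \<le> t \<Longrightarrow> t \<le> 1 \<Longrightarrow> \<bar>f' t\<bar> \<le> C * \<bar>f t\<bar>"
    and "f 0 = 0"
  shows "f 1 = 0"
proof -
  define E where "E t = exp (- (2 * C * t)) * (f t)\<^sup>2" for t
  have "E 1 \<le> E 0"
  proof (rule DERIV_nonpos_imp_nonincreasing[OF zero_le_one])
    fix t :: real assume t: "0 \<le> t" "t \<le> 1"
    have "f t * f' t \<le> \<bar>f t\<bar> * (C * \<bar>f t\<bar>)"
      using bound[OF t] by (metis abs_ge_self abs_ge_zero abs_mult mult_left_mono order_trans)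
    then have "2 * f t * f' t - 2 * C * (f t)\<^sup>2 \<le> 0"
      by (simp add: power2_eq_square algebra_simps flip: abs_mult)
    then have "exp (- (2 * C * t)) * (2 * f t * f' t - 2 * C * (f t)\<^sup>2) \<le> 0"
      by (simp add: mult_le_0_iff)
    moreover have "(E has_real_derivative
        exp (- (2 * C * t)) * (2 * f t * f' t - 2 * C * (f t)\<^sup>2)) (at t)"
      unfolding E_def by (rule derivative_eq_intros der[OF t] refl)+ (simp add: algebra_simps)
    ultimately show "\<exists>y. DERIV E t :> y \<and> y \<le> 0"
      by blast
  qed
  then have "exp (- (2 * C)) * (f 1)\<^sup>2 \<le> 0"
    by (simp add: E_def \<open>f 0 = 0\<close>)
  then show ?thesis
    by (simp add: mult_le_0_iff)
qed

text \<open>Restrict \<open>u\<close> to the segment from the centre \<open>x\<close> to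
  \<open>y\<close>, parametrised over [0, 1]. The derivative along it is \<open>u'\<close> applied
  to \<open>e = y - x\<close>, so the one-dimensional result applies with constant
  \<open>C * norm e\<close>.\<close>

lemma zero_on_ball:
  fixes u :: "'v::real_normed_vector \<Rightarrow> real"
  assumes der: "\<And>y. y \<in> ball x r \<Longrightarrow> (u has_derivative u' y) (at y)"
    and bound: "\<And>y e. y \<in> ball x r \<Longrightarrow> \<bar>u' y e\<bar> \<le> C * \<bar>u y\<bar> * norm e"
    and "u x = 0" and y: "y \<in> ball x r"
  shows "u y = 0"
proof -
  define e where "e = y - x"
  have in_ball: "x + t *\<^sub>R e \<in> ball x r" if "0 \<le> t" "t \<le> 1" for t
  proof -
    have "t * norm e \<le> 1 * norm e"
      using that by (intro mult_right_mono) auto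
    then show ?thesis
      using y that by (simp add: e_def dist_norm norm_minus_commute)
  qed
  have "u (x + 1 *\<^sub>R e) = 0"
  proof (rule gronwall_zero[where f = "\<lambda>t. u (x + t *\<^sub>R e)"])
    fix t :: real assume t: "0 \<le> t" "t \<le> 1"
    have lin: "linear (u' (x + t *\<^sub>R e))"
      using der[OF in_ball[OF t]] has_derivative_linear by blast
    have "((\<lambda>t. u (x + t *\<^sub>R e)) has_derivative (\<lambda>s. u' (x + t *\<^sub>R e) (s *\<^sub>R e))) (at t)"
      by (rule has_derivative_compose[where f = "\<lambda>t. x + t *\<^sub>R e" and g = u, OF _ der[OF in_ball[OF t]]])
         (auto intro!: derivative_eq_intros)
    then show "((\<lambda>t. u (x + t *\<^sub>R e)) has_real_derivative u' (x + t *\<^sub>R e) e) (at t)"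
      by (simp add: has_real_derivative_iff_has_vector_derivative has_vector_derivative_def
          linear_cmul[OF lin])
    show "\<bar>u' (x + t *\<^sub>R e) e\<bar> \<le> (C * norm e) * \<bar>u (x + t *\<^sub>R e)\<bar>"
      using bound[OF in_ball[OF t], of e] by (simp add: mult_ac)
  qed (simp add: \<open>u x = 0\<close>)
  then show ?thesis
    by (simp add: e_def)
qed


subsection \<open>Charts\<close>

text \<open>These are the components of the covector \<open>df\<close>, before an index is raised;
  \<open>gradient\<close> applies the inverse metric matrix to them.\<close>

abbreviation differential :: "(real^2 \<Rightarrow> real) \<Rightarrow> real^2 \<Rightarrow> real^2" where
  "differential f x \<equiv> \<chi> j. partial j f x"

lemma frechet_derivative_eq_inner:
  assumes "f differentiable (at x)"
  shows "frechet_derivative f (at x) e = differential f x \<bullet> e"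
proof -
  have lin: "linear (frechet_derivative f (at x))"
    using assms by (rule linear_frechet_derivative)
  have "frechet_derivative f (at x) e
      = frechet_derivative f (at x) (\<Sum>i\<in>UNIV. e $ i *\<^sub>R axis i 1)"
    using basis_expansion[of e] by (simp add: scalar_mult_eq_scaleR)
  also have "\<dots> = differential f x \<bullet> e"
    by (simp add: linear_sum[OF lin] linear_cmul[OF lin] inner_vec_def partial_def mult.commute)
  finally show ?thesis .
qed

text \<open>Covectors pull back by the transposed Jacobian. The function \<open>k\<close> is
  separate from the composite because the two expressions of a function on the surface are related
  by the transition map only on the chart overlap; agreement on the open set \<open>S\<close> around
  \<open>x\<close> suffices for derivatives.\<close>

lemma differential_chain:
  assumes f: "f differentiable (at (\<phi> x))" and \<phi>: "\<phi> differentiable (at x)"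
    and S: "open S" "x \<in> S" "\<And>y. y \<in> S \<Longrightarrow> k y = f (\<phi> y)"
  shows "differential k x = transpose (jacobian \<phi> (at x)) *v differential f (\<phi> x)"
proof -
  have "((\<lambda>y. f (\<phi> y)) has_derivative
      (\<lambda>e. differential f (\<phi> x) \<bullet> (jacobian \<phi> (at x) *v e))) (at x)"
    using has_derivative_compose[OF \<phi>[unfolded jacobian_works] f[unfolded frechet_derivative_works]]
    by (simp add: frechet_derivative_eq_inner[OF f])
  then have "(k has_derivative
      (\<lambda>e. differential f (\<phi> x) \<bullet> (jacobian \<phi> (at x) *v e))) (at x)"
    by (rule has_derivative_transform_within_open[OF _ S(1,2)]) (simp add: S(3))
  then have "frechet_derivative k (at x)
      = (\<lambda>e. (transpose (jacobian \<phi> (at x)) *v differential f (\<phi> x)) \<bullet> e)"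
    unfolding transpose_inner by (rule frechet_derivative_at[symmetric])
  then show ?thesis
    by (simp add: vec_eq_iff partial_def inner_axis)
qed

section \<open>Topology of charts\<close>

lemma chart_open_image:
  assumes "is_chart M c" "openin M U" "U \<subseteq> dom_chart c"
  shows "open (coord c ` U)"
proof -
  have "open_map (subtopology M (dom_chart c)) (top_of_set (codom_chart c)) (coord c)"
    using assms(1) by (auto simp: is_chart_def intro: homeomorphic_imp_open_map)
  moreover have "openin (subtopology M (dom_chart c)) U"
    using assms by (simp add: is_chart_def openin_open_subtopology)
  ultimately have "openin (top_of_set (codom_chart c)) (coord c ` U)"
    by (simp add: open_map_def)
  then show ?thesis
    using assms(1) by (auto simp: is_chart_def intro: openin_open_trans)
qed

lemma chart_openin_preimage:
  assumes "is_chart M c" "open V"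
  shows "openin M {q \<in> dom_chart c. coord c q \<in> V}"
proof -
  have c: "openin M (dom_chart c)"
    and cont: "continuous_map (subtopology M (dom_chart c)) (top_of_set (codom_chart c)) (coord c)"
    using assms(1) by (auto simp: is_chart_def intro: homeomorphic_imp_continuous_map)
  have "openin (top_of_set (codom_chart c)) (codom_chart c \<inter> V)"
    using assms(2) by (rule openin_open_Int)
  from openin_continuous_map_preimage[OF cont this]
  have "openin (subtopology M (dom_chart c))
      {q \<in> topspace (subtopology M (dom_chart c)). coord c q \<in> codom_chart c \<inter> V}" .
  moreover have "{q \<in> topspace (subtopology M (dom_chart c)). coord c q \<in> codom_chart c \<inter> V}
      = {q \<in> dom_chart c. coord c q \<in> V}"
    using openin_subset[OF c] by auto
  ultimately show ?thesis
    using openin_trans_full[OF _ c] by simp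
qed

lemma chart_inj_on:
  assumes "is_chart M c"
  shows "inj_on (coord c) (dom_chart c)"
proof -
  have "inj_on (coord c) (topspace (subtopology M (dom_chart c)))"
    using assms unfolding is_chart_def by (blast intro: homeomorphic_imp_injective_map)
  moreover have "topspace (subtopology M (dom_chart c)) = dom_chart c"
    using assms openin_subset by (auto simp: is_chart_def)
  ultimately show ?thesis by simp
qed

lemma inv_coord_coord:
  assumes "is_chart M c" "p \<in> dom_chart c"
  shows "inv_coord c (coord c p) = p"
  using assms by (simp add: inv_coord_def chart_inj_on)

text \<open>The preimage of an open set \<open>B\<close> is the coordinate image of the part of the
  chart domain where \<open>f\<close> lies in \<open>B\<close>. That part is open in
  \<open>M\<close>, and charts map open sets to open sets.\<close>

lemma continuous_on_comp_inv_coord: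
  fixes f :: "'a \<Rightarrow> real"
  assumes c: "is_chart M c" and f: "continuous_map M euclideanreal f"
  shows "continuous_on (codom_chart c) (f \<circ> inv_coord c)"
proof -
  have oc: "open (codom_chart c)" and dom: "dom_chart c \<subseteq> topspace M"
    using c by (auto simp: is_chart_def openin_subset)
  show ?thesis
    unfolding continuous_on_open_vimage[OF oc]
  proof (intro allI impI)
    fix B :: "real set" assume "open B"
    have "openin M {q \<in> topspace M. f q \<in> B}"
      using f \<open>open B\<close> openin_continuous_map_preimage by fastforce
    then have "openin M (dom_chart c \<inter> {q \<in> topspace M. f q \<in> B})"
      using c by (auto simp: is_chart_def)
    then have "open (coord c ` (dom_chart c \<inter> {q \<in> topspace M. f q \<in> B}))"
      by (rule chart_open_image[OF c]) simp
    moreover have "coord c ` (dom_chart c \<inter> {q \<in> topspace M. f q \<in> B})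
        = (f \<circ> inv_coord c) -` B \<inter> codom_chart c"
      using dom by (auto simp: inv_coord_coord[OF c])
    ultimately show "open ((f \<circ> inv_coord c) -` B \<inter> codom_chart c)"
      by simp
  qed
qed

lemma Ck_on_Suc_differentiable:
  assumes "Ck_on (Suc k) f S" "open S" "x \<in> S"
  shows "f differentiable (at x)"
  using assms by (simp add: differentiable_on_eq_differentiable_at)


subsection \<open>Surfaces\<close>

lemma C2_surface_differentiable:
  assumes "C2_surface A v" "c \<in> A" "is_chart M c" "x \<in> codom_chart c"
  shows "(v \<circ> inv_coord c) differentiable (at x)"
proof (rule Ck_on_Suc_differentiable)
  show "Ck_on (Suc 1) (v \<circ> inv_coord c) (codom_chart c)"
    using assms(1,2) unfolding C2_surface_def numeral_2_eq_2 One_nat_def by blast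
qed (use assms(3,4) in \<open>simp_all add: is_chart_def\<close>)

text \<open>\<open>field_norm\<close> is evaluated in the arbitrary chart picked by
  \<open>chart_at\<close>. The transformation law of the metric and the chain rule for the
  differential allow it to be computed in any chart around \<open>p\<close>.\<close>

lemma gradient_norm_chart:
  assumes surf: "riemannian_surface M A G" and v: "C2_surface A v"
    and c: "c \<in> A" "p \<in> dom_chart c"
  defines "X \<equiv> gradient G v c (coord c p)"
  shows "(field_norm A G (gradient G v) p)\<^sup>2 = X \<bullet> (G c (coord c p) *v X)"
proof -
  define d where "d = chart_at A p"
  have d: "d \<in> A" "p \<in> dom_chart d"
    unfolding d_def chart_at_def by (rule someI2[of _ c]; use c in simp)+
  have charts: "is_chart M b" if "b \<in> A" for b
    using surf that by (simp add: riemannian_surface_def smooth_surface_def)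
  \<comment> \<open>The direction is from the picked chart \<open>d\<close> to the given chart
    \<open>c\<close>, so that the matrix of \<open>d\<close> is the congruence transform of the
    matrix of \<open>c\<close>.\<close>
  define \<phi> where "\<phi> = transition d c"
  define J where "J = jacobian \<phi> (at (coord d p))"
  define S where "S = coord d ` (dom_chart d \<inter> dom_chart c)"
  have S: "open S" "coord d p \<in> S"
    unfolding S_def using c d charts[OF c(1)] charts[OF d(1)]
    by (auto intro!: chart_open_image[of M d] simp: is_chart_def)
  have \<phi>p: "\<phi> (coord d p) = coord c p"
    using d charts by (simp add: \<phi>_def transition_def inv_coord_coord[of M])
  have pos: "0 < w \<bullet> (G b (coord b p) *v w)" if "b \<in> A" "p \<in> dom_chart b" "w \<noteq> 0" for b w
    using surf that by (auto simp: riemannian_surface_def riemannian_metric_def)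
  have inv: "invertible (G b (coord b p))" if "b \<in> A" "p \<in> dom_chart b" for b
    using pos[OF that] by (rule positive_definite_invertible)
  have "smooth_on \<phi> S"
    using surf c d by (simp add: \<phi>_def S_def riemannian_surface_def smooth_surface_def)
  then have \<phi>: "\<phi> differentiable (at (coord d p))"
    using Ck_on_Suc_differentiable S smooth_on_def by blast
  have dv: "(v \<circ> inv_coord c) differentiable (at (\<phi> (coord d p)))"
    unfolding \<phi>p using c by (intro C2_surface_differentiable[OF v c(1) charts[OF c(1)]]) simp
  have "differential (v \<circ> inv_coord d) (coord d p)
      = transpose J *v differential (v \<circ> inv_coord c) (coord c p)"
    unfolding J_def \<phi>p[symmetric]
    by (rule differential_chain[OF dv \<phi> S])
       (use charts c d in \<open>auto simp: S_def \<phi>_def transition_def inv_coord_coord[OF charts[OF c(1)]]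
        inv_coord_coord[OF charts[OF d(1)]]\<close>)
  moreover have "G d (coord d p) = transpose J ** G c (coord c p) ** J"
    using surf c d S(2) unfolding \<phi>p[symmetric] J_def \<phi>_def S_def
    by (auto simp: riemannian_surface_def riemannian_metric_def)
  ultimately have "gradient G v d (coord d p) \<bullet> (G d (coord d p) *v gradient G v d (coord d p))
      = X \<bullet> (G c (coord c p) *v X)"
    unfolding X_def gradient_def
    using inverse_quadratic_form_congruence[OF inv[OF d] inv[OF c]] by simp
  \<comment> \<open>Non-negativity lets the square cancel the square root in
    \<open>field_norm\<close>.\<close>
  moreover have "0 \<le> X \<bullet> (G c (coord c p) *v X)"
    using pos[OF c, of X] by (cases "X = 0") auto
  ultimately show ?thesis
    by (simp add: field_norm_def d_def Let_def)
qed

section \<open>Openness of the zero set and of its complement\<close>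

text \<open>On a compact coordinate ball around \<open>p\<close> the metric matrix and
  \<open>h\<close> are bounded, so the gradient bound becomes a Euclidean bound of the differential
  by a constant times the function. The zero at the centre then spreads over the open ball.\<close>

lemma zero_set_nhd:
  assumes surf: "riemannian_surface M A G" and v: "C2_surface A v"
    and h: "continuous_map M euclideanreal h"
    and bound: "\<forall>p\<in>topspace M. (field_norm A G (gradient G v) p)\<^sup>2 \<le> h p * (v p)\<^sup>2"
    and p: "p \<in> topspace M" "v p = 0"
  shows "\<exists>U. openin M U \<and> p \<in> U \<and> (\<forall>q\<in>U. v q = 0)"
proof -
  obtain c where c: "c \<in> A" "p \<in> dom_chart c" "is_chart M c"
    using surf p unfolding riemannian_surface_def smooth_surface_def by blast
  define u where "u = v \<circ> inv_coord c"
  have oc: "open (codom_chart c)" and dom: "dom_chart c \<subseteq> topspace M"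
    using c(3) by (auto simp: is_chart_def openin_subset)
  \<comment> \<open>The closed ball supplies compactness for the bounds \<open>N\<close> and
    \<open>H\<close>; zeros are propagated in its open interior.\<close>
  obtain r where r: "0 < r" "cball (coord c p) r \<subseteq> codom_chart c"
    using open_contains_cball oc c(2) by blast
  let ?B = "cball (coord c p) r"
  have "continuous_on (codom_chart c) (G c)"
    using surf c(1) unfolding riemannian_surface_def riemannian_metric_def smooth_on_def
    by (metis Ck_on.simps(1))
  then have "compact (G c ` ?B)"
    using r(2) by (intro compact_continuous_image) (auto intro: continuous_on_subset)
  then obtain N where N: "0 < N" "\<And>x. x \<in> ?B \<Longrightarrow> norm (G c x) \<le> N"
    using compact_imp_bounded bounded_pos by (metis imageI)
  have "compact ((h \<circ> inv_coord c) ` ?B)"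
    using continuous_on_comp_inv_coord[OF c(3) h] r(2)
    by (intro compact_continuous_image) (auto intro: continuous_on_subset)
  then obtain H where H: "0 < H" "\<And>x. x \<in> ?B \<Longrightarrow> norm ((h \<circ> inv_coord c) x) \<le> H"
    using compact_imp_bounded bounded_pos by (metis imageI)
  \<comment> \<open>This is the constant of \<open>quadratic_form_bound\<close> in dimension two: on
    the ball it bounds the metric by \<open>K\<close> times the Euclidean one.\<close>
  define K where "K = real CARD(2) * real CARD(2) * N"
  have K: "0 < K"
    using N(1) by (simp add: K_def)
  have der: "u differentiable (at x)" if "x \<in> codom_chart c" for x
    unfolding u_def using C2_surface_differentiable[OF v c(1,3) that] .
  \<comment> \<open>The constant comes from the chain
    \<open>|du|^2 \<le> K |grad v|^2 \<le> K h v^2 \<le> K H u^2\<close>, with the gradient norm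
    taken in the metric.\<close>
  have du: "norm (differential u x) \<le> sqrt (K * H) * \<bar>u x\<bar>" if x: "x \<in> ?B" for x
  proof -
    obtain q where q: "q \<in> dom_chart c" "x = coord c q"
      using x r(2) by auto
    have iq: "inv_coord c x = q"
      using q c(3) by (simp add: inv_coord_coord[OF c(3)])
    have metric: "transpose (G c x) = G c x" "\<And>w. w \<noteq> 0 \<Longrightarrow> 0 < w \<bullet> (G c x *v w)"
      using surf c(1) q by (auto simp: riemannian_surface_def riemannian_metric_def)
    have "(norm (differential u x))\<^sup>2
        \<le> K * (gradient G v c x \<bullet> (G c x *v gradient G v c x))"
      unfolding gradient_def u_def[symmetric]
      by (rule norm_le_inverse_quadratic_form[OF metric K])
         (use quadratic_form_bound[OF N(2)[OF x]] in \<open>simp_all add: K_def\<close>)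
    also have "\<dots> = K * (field_norm A G (gradient G v) q)\<^sup>2"
      using gradient_norm_chart[OF surf v c(1) q(1)] q(2) by simp
    also have "\<dots> \<le> K * (h q * (v q)\<^sup>2)"
      using bound q(1) dom K by auto
    also have "\<dots> \<le> K * (H * (v q)\<^sup>2)"
      using H(2)[OF x] K by (intro mult_left_mono mult_right_mono) (auto simp: iq)
    also have "\<dots> = (sqrt (K * H) * \<bar>u x\<bar>)\<^sup>2"
      using K H(1) by (simp add: power_mult_distrib u_def iq)
    finally show ?thesis
      using K H(1) by (auto intro: power2_le_imp_le)
  qed
  have "u x = 0" if "x \<in> ball (coord c p) r" for x
  proof (rule zero_on_ball[OF _ _ _ that])
    fix y e assume y: "y \<in> ball (coord c p) r"
    then have yB: "y \<in> ?B" by simp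
    then have dy: "u differentiable (at y)"
      using der r(2) by blast
    then show "(u has_derivative frechet_derivative u (at y)) (at y)"
      by (simp add: frechet_derivative_works)
    show "\<bar>frechet_derivative u (at y) e\<bar> \<le> sqrt (K * H) * \<bar>u y\<bar> * norm e"
      unfolding frechet_derivative_eq_inner[OF dy]
      using Cauchy_Schwarz_ineq2[of "differential u y" e] mult_right_mono[OF du[OF yB], of "norm e"]
      by auto
  qed (use c p in \<open>simp add: u_def inv_coord_coord[OF c(3)]\<close>)
  then have "\<forall>q\<in>{q \<in> dom_chart c. coord c q \<in> ball (coord c p) r}. v q = 0"
    using inv_coord_coord[OF c(3)] unfolding u_def comp_def by fastforce
  moreover have "openin M {q \<in> dom_chart c. coord c q \<in> ball (coord c p) r}"
    using chart_openin_preimage[OF c(3)] by blast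
  ultimately show ?thesis
    using c(2) r(1) by (intro exI[of _ "{q \<in> dom_chart c. coord c q \<in> ball (coord c p) r}"]) auto
qed

text \<open>Regularity of \<open>v\<close> is expressed only in charts, so continuity is used there:
  the set where the local expression is nonzero is open in the plane and is pulled back to
  \<open>M\<close>.\<close>

lemma nonzero_nhd:
  assumes surf: "smooth_surface M A" and v: "C2_surface A v"
    and p: "p \<in> topspace M" "v p \<noteq> 0"
  shows "\<exists>U. openin M U \<and> p \<in> U \<and> (\<forall>q\<in>U. v q \<noteq> 0)"
proof -
  obtain c where c: "c \<in> A" "p \<in> dom_chart c" "is_chart M c"
    using surf p unfolding smooth_surface_def by blast
  have oc: "open (codom_chart c)"
    using c(3) by (simp add: is_chart_def)
  have "continuous_on (codom_chart c) (v \<circ> inv_coord c)"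
    using C2_surface_differentiable[OF v c(1,3)] differentiable_imp_continuous_within
    by (blast intro: continuous_at_imp_continuous_on)
  then have "open ((v \<circ> inv_coord c) -` (- {0}) \<inter> codom_chart c)"
    using continuous_on_open_vimage[OF oc] by blast
  from chart_openin_preimage[OF c(3) this] c show ?thesis
    using p by (intro exI[of _ "{q \<in> dom_chart c.
        coord c q \<in> (v \<circ> inv_coord c) -` (- {0}) \<inter> codom_chart c}"])
      (auto simp: inv_coord_coord[OF c(3)], metis inv_coord_coord)
qed

lemma openin_Collect_nhd:
  assumes "\<And>p. p \<in> topspace M \<Longrightarrow> P p \<Longrightarrow> \<exists>U. openin M U \<and> p \<in> U \<and> (\<forall>q\<in>U. P q)"
  shows "openin M {p \<in> topspace M. P p}"
proof (subst openin_subopen, clarify)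
  fix p assume "p \<in> topspace M" "P p"
  then obtain U where U: "openin M U" "p \<in> U" "\<forall>q\<in>U. P q"
    using assms by blast
  then have "U \<subseteq> {p \<in> topspace M. P p}"
    using openin_subset by blast
  with U show "\<exists>T. openin M T \<and> p \<in> T \<and> T \<subseteq> {p \<in> topspace M. P p}"
    by blast
qed

theorem lemma7p1:
  fixes M :: "'a topology" and A :: "'a chart set"
    and G :: "'a chart \<Rightarrow> real^2 \<Rightarrow> real^2^2"
    and g h v :: "'a \<Rightarrow> real"
  assumes "riemannian_surface M A G" and "connected_space M"
    and "continuous_map M euclideanreal g"
    and "continuous_map M euclideanreal h" and "\<forall>p\<in>topspace M. 0 \<le> h p"
    and "C2_surface A v"
    and "\<forall>p\<in>topspace M. (field_norm A G (gradient G v) p)\<^sup>2 \<le> h p * (v p)\<^sup>2"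
    and "\<forall>p\<in>topspace M. laplacian A G v p + g p * v p = 0"
  shows "(\<forall>p\<in>topspace M. v p \<noteq> 0) \<or> (\<forall>p\<in>topspace M. v p = 0)"
proof -
  have surf: "smooth_surface M A"
    using assms(1) by (simp add: riemannian_surface_def)
  have "openin M {p \<in> topspace M. v p = 0}"
    by (rule openin_Collect_nhd) (rule zero_set_nhd[OF assms(1,6,4,7)])
  \<comment> \<open>This is the closedness of the zero set, stated for its complement as the
    connectedness criterion asks for two open sets.\<close>
  moreover have "openin M {p \<in> topspace M. v p \<noteq> 0}"
    by (rule openin_Collect_nhd) (rule nonzero_nhd[OF surf assms(6)])
  ultimately show ?thesis
    using connected_spaceD[OF assms(2), of "{p \<in> topspace M. v p = 0}" "{p \<in> topspace M. v p \<noteq> 0}"]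
    by blast
qed

end
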